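(* Let $\alpha\in(0,1)$ and let $X$ be a random variable with characteristic function $\mathbb{E}e^{itX}=\exp\left(\int_0^\infty(e^{itx}-1)\frac{dx}{x^{\alpha+1}}\right)$, $t\in\mathbb{R}$. Then for every $y\ge(1/\alpha)^{1/\alpha}$, $$\mathbb{P}\Big(X>\frac{1}{1-\alpha}+3y\Big)\le\frac{2}{\alpha y^{\alpha}},$$ and for every $y\ge1$ and $\theta\in(0,1)$, $$\mathbb{P}\Big(X\ge\frac{\theta}{1-\alpha}+y\Big)\ge\frac{2}{3}(1-\theta)^2\frac{1}{1+\alpha y^{\alpha}}.$$
   Context: $X$ is a totally asymmetric strictly $\alpha$-stable random variable; equivalently $X\overset{d}{=}\sum_{i\ge1}(\alpha\tau_i)^{-1/\alpha}$ where $\tau_i=\Gamma_1+\dots+\Gamma_i$ with $(\Gamma_k)$ i.i.d. standard exponential. *)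

theory Defs
  imports "HOL-Probability.Probability"
begin

end

theory Submission
  imports Defs
begin

text \<open>
  The variable X is the weak limit of sums of independent Pareto variables: if Z has density
  x powr (-\<alpha> - 1) / N above the cutoff at which the total mass is 1, then N such variables carry the
  Levy measure x powr (-\<alpha> - 1) dx as N grows. Take N copies truncated to values at most s, with sum A,
  and N independent copies restricted to values above s, with sum B, so that A and B are independent;
  Levy's continuity theorem gives the convergence of A + B to X.

  For the upper bound take s = y. Then B is nonzero with probability at most 1 / (\<alpha> y powr \<alpha>), and
  Chebyshev's inequality controls A, whose mean is at most y powr (1 - \<alpha>) / (1 - \<alpha>) \<le> 1 / (1 - \<alpha>) + y
  and whose variance is at most y powr (2 - \<alpha>) / (2 - \<alpha>). For the lower bound take s = 1. The
  Paley-Zygmund inequality bounds the probability of A \<ge> \<theta> / (1 - \<alpha>), and with u = 1 / (\<alpha> y powr \<alpha>) the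
  probability that some copy in B exceeds y is 1 - (1 - u / N) ^ N \<ge> 1 - exp (- u) \<ge> u / (1 + u).
\<close>

section \<open>Moments and weak limits\<close>

text \<open>With z = c n / (n + 1), the hypothesis forces Re z \<le> 0, so 1 + z and exp z both lie
  in the closed unit disc. There the difference of (n + 1)-th powers is at most n + 1 times the
  difference of the bases, which is O(1 / n^2) by Taylor's theorem. The norm hypothesis is the form
  in which the bound on characteristic functions enters.\<close>

lemma exp_limit_Suc:
  fixes c :: "nat \<Rightarrow> complex"
  assumes lim: "c \<longlonglongrightarrow> c0" and le: "\<And>n. norm (1 + c n / of_nat (Suc n)) \<le> 1"
  shows "(\<lambda>n. (1 + c n / of_nat (Suc n)) ^ Suc n) \<longlonglongrightarrow> exp c0"
proof -
  obtain K where K: "\<And>n. norm (c n) \<le> K"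
    using convergent_imp_Bseq[of c] lim by (auto simp: convergent_def Bseq_def)
  \<comment> \<open>The constant 3 bounds exp 1: once n + 1 \<ge> K, the norm of z is at most 1, so
    the Taylor factor \<open>exp \<bar>Re ?z\<bar>\<close> is at most exp 1.\<close>
  have bound: "norm ((1 + c n / of_nat (Suc n)) ^ Suc n - exp (c n)) \<le> 3 * K\<^sup>2 / real (Suc n)"
    if n: "K \<le> real (Suc n)" for n
  proof -
    let ?z = "c n / of_nat (Suc n)"
    have "1 + Re ?z \<le> norm (1 + ?z)"
      using complex_Re_le_cmod[of "1 + ?z"] by simp
    then have "Re ?z \<le> 0" using le[of n] by linarith
    then have exp_z: "norm (exp ?z) \<le> 1" by simp
    have "norm ?z = norm (c n) / real (Suc n)"
      by (simp only: norm_divide norm_of_nat)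
    then have z_le: "norm ?z \<le> K / real (Suc n)"
      using K[of n] by (simp add: divide_right_mono del: of_nat_Suc)
    also have "\<dots> \<le> 1" using n by (simp add: divide_le_eq)
    finally have "\<bar>Re ?z\<bar> \<le> 1" using abs_Re_le_cmod[of ?z] by linarith
    then have "exp \<bar>Re ?z\<bar> \<le> 3" using exp_le by (meson exp_le_cancel_iff order_trans)
    have "norm (exp ?z - (1 + ?z)) \<le> exp \<bar>Re ?z\<bar> * (norm ?z)\<^sup>2"
      using Taylor_exp[of ?z 1] by (simp add: numeral_2_eq_2)
    also have "\<dots> \<le> 3 * (K / real (Suc n))\<^sup>2"
      using z_le \<open>exp \<bar>Re ?z\<bar> \<le> 3\<close> by (intro mult_mono power_mono) auto
    finally have 1: "norm (1 + ?z - exp ?z) \<le> 3 * (K / real (Suc n))\<^sup>2"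
      by (simp add: norm_minus_commute)
    have "exp (c n) = exp ?z ^ Suc n"
      by (subst exp_of_nat_mult[symmetric]) (simp add: field_simps del: of_nat_Suc)
    then have "norm ((1 + ?z) ^ Suc n - exp (c n)) \<le> Suc n * norm (1 + ?z - exp ?z)"
      using norm_power_diff[OF le[of n] exp_z, of "Suc n"] by metis
    also have "\<dots> \<le> Suc n * (3 * (K / real (Suc n))\<^sup>2)"
      using 1 by (intro mult_left_mono) auto
    also have "\<dots> = 3 * K\<^sup>2 / real (Suc n)"
      by (simp add: power2_eq_square field_simps del: of_nat_Suc)
    finally show ?thesis .
  qed
  have "(\<lambda>n. 3 * K\<^sup>2 / real (Suc n)) \<longlonglongrightarrow> 0"
    by (rule LIMSEQ_Suc[OF lim_const_over_n])
  moreover have "\<forall>\<^sub>F n in sequentially. K \<le> real (Suc n)"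
  proof -
    obtain m where "K \<le> real m" using real_arch_simple by blast
    then show ?thesis by (intro eventually_sequentiallyI[of m]) linarith
  qed
  ultimately have "(\<lambda>n. (1 + c n / of_nat (Suc n)) ^ Suc n - exp (c n)) \<longlonglongrightarrow> 0"
    by (intro Lim_null_comparison[OF eventually_mono[OF _ bound]])
  from tendsto_add[OF this tendsto_exp[OF lim]] show ?thesis by simp
qed

text \<open>A Paley-Zygmund inequality. The quadratic 2 c (A - a) - (c A)^2 lies below the indicator
  of a \<le> A: on the event this is 2 u - u^2 \<le> 1 with u = c A, using a \<ge> 0, and off the
  event both terms are nonpositive. The second moment enters only through an upper bound
  \<open>K\<close>, so that one constant can serve a whole sequence of variables.\<close>

lemma (in prob_space) second_moment_lower_tail:
  fixes A :: "'a \<Rightarrow> real"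
  assumes [measurable]: "random_variable borel A" and int: "integrable M (\<lambda>x. (A x)\<^sup>2)"
    and "0 \<le> a" "a \<le> expectation A" and K: "expectation (\<lambda>x. (A x)\<^sup>2) \<le> K" "0 < K"
  shows "(expectation A - a)\<^sup>2 / K \<le> prob {x \<in> space M. a \<le> A x}"
proof -
  \<comment> \<open>Maximises the lower bound 2 c (E A - a) - c^2 K, obtained by integrating a pointwise inequality.\<close>
  define c where "c = (expectation A - a) / K"
  have c: "0 \<le> c" using assms by (simp add: c_def)
  have [simp]: "integrable M A"
    by (rule square_integrable_imp_integrable[OF _ int]) simp
  have "2 * c * (A x - a) - (c * A x)\<^sup>2 \<le> indicator {x \<in> space M. a \<le> A x} x"
    if "x \<in> space M" for x
  proof (cases "a \<le> A x")
    case True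
    have "2 * c * (A x - a) \<le> 2 * (c * A x)"
      using mult_left_mono[of "A x - a" "A x" "2 * c"] assms(3) c by (simp add: mult.assoc)
    moreover have "2 * (c * A x) - (c * A x)\<^sup>2 \<le> 1"
      using zero_le_power2[of "c * A x - 1"] by (simp add: power2_diff)
    ultimately show ?thesis using True that by auto
  next
    case False
    then have "2 * c * (A x - a) \<le> 0"
      using c by (intro mult_nonneg_nonpos) auto
    then show ?thesis using False by (auto intro: order_trans[OF _ zero_le_power2] simp del: mult_le_0_iff)
  qed
  then have "expectation (\<lambda>x. 2 * c * (A x - a) - c\<^sup>2 * (A x)\<^sup>2) \<le>
     expectation (indicator {x \<in> space M. a \<le> A x})"
    using int by (intro integral_mono) (auto simp: power_mult_distrib less_top[symmetric])
  then have "2 * c * (expectation A - a) - c\<^sup>2 * expectation (\<lambda>x. (A x)\<^sup>2) \<le> prob {x \<in> space M. a \<le> A x}"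
    using int by (simp add: prob_space)
  moreover have "c\<^sup>2 * expectation (\<lambda>x. (A x)\<^sup>2) \<le> c\<^sup>2 * K"
    using K by (intro mult_left_mono) auto
  moreover have "2 * c * (expectation A - a) - c\<^sup>2 * K = (expectation A - a)\<^sup>2 / K"
    using K by (simp add: c_def field_simps power2_eq_square)
  ultimately show ?thesis by linarith
qed

text \<open>By induction: independence factorises the cross term between the new summand and the old
  sum. The right-hand side exceeds the exact value by the squares of the individual means, hence the
  inequality.\<close>

lemma (in prob_space) second_moment_indep_sum:
  fixes X :: "'i \<Rightarrow> 'a \<Rightarrow> real"
  assumes "finite I" "indep_vars (\<lambda>_. borel) X I"
    and "\<And>i. i \<in> I \<Longrightarrow> integrable M (\<lambda>x. (X i x)\<^sup>2)"
  shows "integrable M (\<lambda>x. (\<Sum>i\<in>I. X i x)\<^sup>2)" (is ?int)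
    and "expectation (\<lambda>x. (\<Sum>i\<in>I. X i x)\<^sup>2)
      \<le> (\<Sum>i\<in>I. expectation (X i))\<^sup>2 + (\<Sum>i\<in>I. expectation (\<lambda>x. (X i x)\<^sup>2))" (is ?le)
proof -
  have "?int \<and> ?le" using assms
  proof (induction I rule: finite_induct)
    case empty show ?case by simp
  next
    case (insert j I)
    have sub: "indep_vars (\<lambda>_. borel) X I"
      using insert.prems by (auto intro: indep_vars_subset)
    let ?S = "\<lambda>x. \<Sum>i\<in>I. X i x"
    have rv [measurable]: "random_variable borel (X i)" if "i \<in> insert j I" for i
      using insert.prems(1) that by (auto simp: indep_vars_def)
    have [measurable]: "random_variable borel ?S" by (intro borel_measurable_sum rv) auto
    have IH: "integrable M (\<lambda>x. (?S x)\<^sup>2)"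
      "expectation (\<lambda>x. (?S x)\<^sup>2) \<le> (\<Sum>i\<in>I. expectation (X i))\<^sup>2 + (\<Sum>i\<in>I. expectation (\<lambda>x. (X i x)\<^sup>2))"
      using insert.IH[OF sub] insert.prems by auto
    have iX: "integrable M (X i)" if "i \<in> insert j I" for i
      by (rule square_integrable_imp_integrable[OF rv[OF that]]) (use insert.prems that in auto)
    have iS: "integrable M ?S" using iX by auto
    have ind: "indep_var borel (X j) borel ?S"
      using insert by (intro indep_vars_sum) auto
    note p = indep_var_integrable[OF ind iX[of j] iS, simplified] indep_var_lebesgue_integral[OF ind iX[of j] iS, simplified]
    have eq: "(\<lambda>x. (\<Sum>i\<in>insert j I. X i x)\<^sup>2) = (\<lambda>x. (X j x)\<^sup>2 + 2 * (X j x * ?S x) + (?S x)\<^sup>2)"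
      using insert by (simp add: power2_sum algebra_simps)
    have j2: "integrable M (\<lambda>x. (X j x)\<^sup>2)" using insert.prems by simp
    have "expectation ?S = (\<Sum>i\<in>I. expectation (X i))" using iX by simp
    then have "expectation (\<lambda>x. (X j x)\<^sup>2 + 2 * (X j x * ?S x) + (?S x)\<^sup>2) =
      expectation (\<lambda>x. (X j x)\<^sup>2) + 2 * (expectation (X j) * (\<Sum>i\<in>I. expectation (X i))) + expectation (\<lambda>x. (?S x)\<^sup>2)"
      using p j2 IH(1) by (simp del: Bochner_Integration.integral_sum integral_sum')
    then show ?case unfolding eq using p(1) j2 IH insert(1,2)
      by (simp add: power2_sum add_increasing)
  qed
  then show ?int ?le by auto
qed

text \<open>The portmanteau inequality for an open half-line: its indicator is the limit of
  continuous functions below it, whose integrals inherit the bound \<open>b\<close> first in n and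
  then in k.\<close>

lemma weak_conv_upper_tail:
  assumes "weak_conv_m \<mu> M" "\<And>n. real_distribution (\<mu> n)" "real_distribution M"
    and le: "\<forall>\<^sub>F n in sequentially. measure (\<mu> n) {c<..} \<le> b"
  shows "measure M {c<..} \<le> b"
proof -
  interpret M: real_distribution M by fact
  interpret \<mu>: real_distribution "\<mu> n" for n by fact
  \<comment> \<open>For k > 0, a ramp rising from 0 at c to 1 at c + 1 / k.\<close>
  define h where "h k x = min 1 (max 0 (real k * (x - c)))" for k x
  have h01: "0 \<le> h k x" "h k x \<le> 1" for k x by (auto simp: h_def)
  have hc: "continuous_on UNIV (h k)" for k unfolding h_def by (intro continuous_intros)
  then have [measurable]: "h k \<in> borel_measurable borel" for k by (rule borel_measurable_continuous_onI)
  have "integral\<^sup>L M (h k) \<le> b" for k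
  proof (rule tendsto_upperbound)
    show "(\<lambda>n. integral\<^sup>L (\<mu> n) (h k)) \<longlonglongrightarrow> integral\<^sup>L M (h k)"
      using hc h01
      by (intro weak_conv_imp_integral_bdd_continuous_conv[OF assms(2,3,1), where B = 1])
         (auto simp: continuous_on_eq_continuous_at)
    show "\<forall>\<^sub>F n in sequentially. integral\<^sup>L (\<mu> n) (h k) \<le> b"
      using le
    proof eventually_elim
      case (elim n)
      have "integral\<^sup>L (\<mu> n) (h k) \<le> integral\<^sup>L (\<mu> n) (indicator {c<..})"
        using h01 by (intro integral_mono \<mu>.integrable_const_bound[where B=1])
          (auto simp: indicator_def h_def mult_nonneg_nonpos)
      then show ?case using elim by simp
    qed
  qed simp
  moreover have "(\<lambda>k. integral\<^sup>L M (h k)) \<longlonglongrightarrow> integral\<^sup>L M (indicator {c<..})"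
  proof (rule integral_dominated_convergence[where w = "\<lambda>_. 1"])
    show "AE x in M. (\<lambda>k. h k x) \<longlonglongrightarrow> indicator {c<..} x"
    proof (intro AE_I2)
      fix x
      show "(\<lambda>k. h k x) \<longlonglongrightarrow> indicator {c<..} x"
      proof (cases "c < x")
        case True
        obtain k0 where k0: "1 / (x - c) \<le> real k0" using real_arch_simple by blast
        have "\<forall>\<^sub>F k in sequentially. h k x = 1"
        proof (rule eventually_sequentiallyI[of k0])
          fix k assume "k0 \<le> k"
          then have "1 / (x - c) \<le> real k" using k0 by linarith
          then have "1 \<le> real k * (x - c)" using True by (simp add: field_simps)
          then show "h k x = 1" by (simp add: h_def)
        qed
        then show ?thesis using True by (auto intro: tendsto_eventually)
      qed (auto simp: h_def mult_nonneg_nonpos)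
    qed
  qed (use h01 in auto)
  ultimately have "integral\<^sup>L M (indicator {c<..}) \<le> b"
    by (intro tendsto_upperbound) auto
  then show ?thesis by simp
qed

text \<open>The counterpart for a closed half-line, approximated by continuous functions above its
  indicator. The bound \<open>b n\<close> may vary with n, since the mean of the truncated sums
  does.\<close>

lemma weak_conv_lower_tail:
  assumes "weak_conv_m \<mu> M" "\<And>n. real_distribution (\<mu> n)" "real_distribution M"
    and le: "\<forall>\<^sub>F n in sequentially. b n \<le> measure (\<mu> n) {c..}" and b: "b \<longlonglongrightarrow> b0"
  shows "b0 \<le> measure M {c..}"
proof -
  interpret M: real_distribution M by fact
  interpret \<mu>: real_distribution "\<mu> n" for n by fact
  \<comment> \<open>For k > 0, a ramp rising from 0 at c - 1 / k to 1 at c.\<close>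
  define h where "h k x = max 0 (min 1 (1 - real k * (c - x)))" for k x
  have h01: "0 \<le> h k x" "h k x \<le> 1" for k x by (auto simp: h_def)
  have hc: "continuous_on UNIV (h k)" for k unfolding h_def by (intro continuous_intros)
  then have [measurable]: "h k \<in> borel_measurable borel" for k by (rule borel_measurable_continuous_onI)
  have "b0 \<le> integral\<^sup>L M (h k)" for k
  proof (rule tendsto_le)
    show "(\<lambda>n. integral\<^sup>L (\<mu> n) (h k)) \<longlonglongrightarrow> integral\<^sup>L M (h k)"
      using hc h01
      by (intro weak_conv_imp_integral_bdd_continuous_conv[OF assms(2,3,1), where B = 1])
         (auto simp: continuous_on_eq_continuous_at)
    show "\<forall>\<^sub>F n in sequentially. b n \<le> integral\<^sup>L (\<mu> n) (h k)"
      using le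
    proof eventually_elim
      case (elim n)
      have "integral\<^sup>L (\<mu> n) (indicator {c..}) \<le> integral\<^sup>L (\<mu> n) (h k)"
        using h01 by (intro integral_mono \<mu>.integrable_const_bound[where B=1])
          (auto simp: indicator_def h_def mult_nonneg_nonpos)
      then show ?case using elim by simp
    qed
  qed (use b in simp_all)
  moreover have "(\<lambda>k. integral\<^sup>L M (h k)) \<longlonglongrightarrow> integral\<^sup>L M (indicator {c..})"
  proof (rule integral_dominated_convergence[where w = "\<lambda>_. 1"])
    show "AE x in M. (\<lambda>k. h k x) \<longlonglongrightarrow> indicator {c..} x"
    proof (intro AE_I2)
      fix x
      show "(\<lambda>k. h k x) \<longlonglongrightarrow> indicator {c..} x"
      proof (cases "x < c")
        case True
        obtain k0 where k0: "1 / (c - x) \<le> real k0" using real_arch_simple by blast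
        have "\<forall>\<^sub>F k in sequentially. h k x = 0"
        proof (rule eventually_sequentiallyI[of k0])
          fix k assume "k0 \<le> k"
          then have "1 / (c - x) \<le> real k" using k0 by linarith
          then have "1 \<le> real k * (c - x)" using True by (simp add: field_simps)
          then show "h k x = 0" by (simp add: h_def)
        qed
        then show ?thesis using True by (auto intro: tendsto_eventually)
      qed (auto simp: h_def mult_nonneg_nonpos)
    qed
  qed (use h01 in auto)
  ultimately have "b0 \<le> integral\<^sup>L M (indicator {c..})"
    by (intro tendsto_lowerbound) auto
  then show ?thesis by simp
qed

section \<open>Pareto variables and the Levy exponent\<close>

text \<open>Carries gauge integrals of powers over to Lebesgue measure: for a nonnegative function,
  a finite gauge integral is a finite nonnegative Lebesgue integral.\<close>

lemma has_bochner_integral_lborel_of_has_integral: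
  fixes f :: "real \<Rightarrow> real"
  assumes [measurable]: "f \<in> borel_measurable borel" "S \<in> sets borel"
    and nn: "\<And>x. x \<in> S \<Longrightarrow> 0 \<le> f x" and hi: "(f has_integral v) S"
  shows "has_bochner_integral lborel (\<lambda>x. indicator S x * f x) v"
proof -
  let ?g = "\<lambda>x. indicator S x * f x"
  have nn': "0 \<le> ?g x" for x using nn by (auto simp: indicator_def)
  have "?g = (\<lambda>x. if x \<in> S then f x else 0)" by auto
  then have "(?g has_integral v) UNIV"
    using hi has_integral_restrict_UNIV[of S f v] by simp
  then have "integral\<^sup>N lebesgue ?g = v \<and> 0 \<le> v"
    using has_integral_iff_nn_integral_lebesgue[of ?g v] nn' by auto
  then show ?thesis
    using nn' by (intro has_bochner_integral_nn_integral) (auto simp: nn_integral_completion)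
qed

lemma has_bochner_integral_powr_at_0:
  fixes a s :: real
  assumes "-1 < a" "0 < s"
  shows "has_bochner_integral lborel (\<lambda>x. indicator {0<..s} x * x powr a) (s powr (a + 1) / (a + 1))"
proof -
  have "has_bochner_integral lborel (\<lambda>x. indicator {0..s} x * x powr a) (s powr (a + 1) / (a + 1))"
    using assms by (intro has_bochner_integral_lborel_of_has_integral has_integral_powr_from_0) auto
  \<comment> \<open>The endpoint 0 contributes nothing, as \<open>0 powr a = 0\<close> for negative
    \<open>a\<close> too.\<close>
  moreover have "indicator {0..s} x * x powr a = indicator {0<..s} x * x powr a" for x
    by (auto simp: indicator_def)
  ultimately show ?thesis by simp
qed

lemma has_bochner_integral_powr_Ioc:
  fixes a r s :: real
  assumes "-1 < a" "0 < r" "r \<le> s"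
  shows "has_bochner_integral lborel (\<lambda>x. indicator {r<..s} x * x powr a)
    ((s powr (a + 1) - r powr (a + 1)) / (a + 1))"
proof -
  have "has_bochner_integral lborel (\<lambda>x. indicator {0<..s} x * x powr a - indicator {0<..r} x * x powr a)
     (s powr (a + 1) / (a + 1) - r powr (a + 1) / (a + 1))"
    using assms by (intro has_bochner_integral_diff has_bochner_integral_powr_at_0) linarith+
  also have "(\<lambda>x. indicator {0<..s} x * x powr a - indicator {0<..r} x * x powr a) =
      (\<lambda>x. indicator {r<..s} x * x powr a)"
    using assms by (auto simp: indicator_def of_bool_def fun_eq_iff)
  finally show ?thesis by (simp add: diff_divide_distrib)
qed

lemma has_bochner_integral_powr_at_top:
  fixes \<alpha> r :: real
  assumes "0 < \<alpha>" "0 < r"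
  shows "has_bochner_integral lborel (\<lambda>x. indicator {r<..} x * x powr (- \<alpha> - 1)) (1 / (\<alpha> * r powr \<alpha>))"
proof -
  have "has_bochner_integral lborel (\<lambda>x. indicator {r..} x * x powr (- \<alpha> - 1))
     (- (r powr (- \<alpha> - 1 + 1)) / (- \<alpha> - 1 + 1))"
    using assms by (intro has_bochner_integral_lborel_of_has_integral has_integral_powr_to_inf) auto
  also have "- (r powr (- \<alpha> - 1 + 1)) / (- \<alpha> - 1 + 1) = 1 / (\<alpha> * r powr \<alpha>)"
    using assms by (simp add: powr_minus field_simps)
  finally show ?thesis
  proof (rule has_bochner_integralI_AE[rotated 2, OF _ _ _, rotated])
    show "AE x in lborel. indicator {r..} x * x powr (- \<alpha> - 1) = indicator {r<..} x * x powr (- \<alpha> - 1)"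
      using AE_lborel_singleton[of r] by eventually_elim (auto simp: indicator_def)
  qed auto
qed

text \<open>The factor \<open>\<alpha> * r powr \<alpha>\<close> is the reciprocal of the mass of x
  powr (- \<alpha> - 1) above r. When it equals 1 / N, the densities of N copies add up to exactly x
  powr (- \<alpha> - 1) above r.\<close>

definition pareto :: "real \<Rightarrow> real \<Rightarrow> real measure" where
  "pareto \<alpha> r = density lborel (\<lambda>x. \<alpha> * r powr \<alpha> * (indicator {r<..} x * x powr (- \<alpha> - 1)))"

lemma sets_pareto [simp, measurable_cong]: "sets (pareto \<alpha> r) = sets borel"
  and space_pareto [simp]: "space (pareto \<alpha> r) = UNIV"
  by (simp_all add: pareto_def)

lemma has_bochner_integral_pareto:
  fixes f :: "real \<Rightarrow> 'b :: {banach, second_countable_topology}"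
  assumes "0 < \<alpha>" and [measurable]: "f \<in> borel_measurable borel"
    and "has_bochner_integral lborel (\<lambda>x. (indicator {r<..} x * x powr (- \<alpha> - 1)) *\<^sub>R f x) v"
  shows "has_bochner_integral (pareto \<alpha> r) f ((\<alpha> * r powr \<alpha>) *\<^sub>R v)"
proof -
  have "has_bochner_integral lborel (\<lambda>x. (\<alpha> * r powr \<alpha>) *\<^sub>R ((indicator {r<..} x * x powr (- \<alpha> - 1)) *\<^sub>R f x)) ((\<alpha> * r powr \<alpha>) *\<^sub>R v)"
    using assms by (intro has_bochner_integral_scaleR_right) auto
  then show ?thesis unfolding pareto_def using assms
    by (intro has_bochner_integral_density) (auto simp: algebra_simps)
qed

lemma has_bochner_integral_pareto_tail:
  assumes "0 < \<alpha>" "0 < r" "r \<le> y"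
  shows "has_bochner_integral (pareto \<alpha> r) (indicator {y<..} :: real \<Rightarrow> real) (r powr \<alpha> / y powr \<alpha>)"
proof -
  have eq: "(\<lambda>x. (indicator {r<..} x * x powr (- \<alpha> - 1)) *\<^sub>R indicator {y<..} x)
    = (\<lambda>x. indicator {y<..} x * x powr (- \<alpha> - 1) :: real)"
    using assms by (auto simp: indicator_def)
  have "has_bochner_integral (pareto \<alpha> r) (indicator {y<..} :: real \<Rightarrow> real)
    ((\<alpha> * r powr \<alpha>) *\<^sub>R (1 / (\<alpha> * y powr \<alpha>)))"
    using assms by (intro has_bochner_integral_pareto) (simp_all only: eq, auto intro: has_bochner_integral_powr_at_top)
  then show ?thesis using assms by simp
qed

lemma prob_space_pareto:
  assumes "0 < \<alpha>" "0 < r"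
  shows "prob_space (pareto \<alpha> r)"
proof
  have "has_bochner_integral (pareto \<alpha> r) (\<lambda>_. 1 :: real) ((\<alpha> * r powr \<alpha>) *\<^sub>R (1 / (\<alpha> * r powr \<alpha>)))"
    using assms has_bochner_integral_powr_at_top[OF assms]
    by (intro has_bochner_integral_pareto) auto
  then have hb: "has_bochner_integral (pareto \<alpha> r) (\<lambda>_. 1 :: real) 1"
    using assms by simp
  \<comment> \<open>Finiteness comes first, because \<open>measure\<close> takes the value 0 on sets
    of infinite \<open>emeasure\<close>.\<close>
  then have "emeasure (pareto \<alpha> r) UNIV < \<infinity>"
    by (simp add: has_bochner_integral_iff integrable_iff_bounded)
  then have "emeasure (pareto \<alpha> r) UNIV = ennreal (measure (pareto \<alpha> r) UNIV)"
    by (simp add: emeasure_eq_ennreal_measure less_top)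
  with hb show "emeasure (pareto \<alpha> r) (space (pareto \<alpha> r)) = 1"
    by (simp add: has_bochner_integral_iff)
qed

lemma pareto_truncated_moment:
  assumes "0 < \<alpha>" "\<alpha> < real k" "0 < r" "r \<le> s"
  shows "has_bochner_integral (pareto \<alpha> r) (\<lambda>x. (indicator {..s} x * x) ^ k)
     (\<alpha> * r powr \<alpha> * ((s powr (k - \<alpha>) - r powr (k - \<alpha>)) / (k - \<alpha>)))"
proof -
  \<comment> \<open>For k = 0 the power would be 1 above s instead of vanishing there.\<close>
  have k: "0 < k" using assms by (cases k) auto
  have eq: "(\<lambda>x. (indicator {r<..} x * x powr (- \<alpha> - 1)) *\<^sub>R (indicator {..s} x * x) ^ k) =
     (\<lambda>x. indicator {r<..s} x * x powr (real k - \<alpha> - 1))"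
  proof
    fix x :: real
    have "x powr (- \<alpha> - 1) * x ^ k = x powr (real k - \<alpha> - 1)" if "0 < x"
      using that by (simp add: powr_realpow[symmetric] powr_add[symmetric] algebra_simps)
    then show "(indicator {r<..} x * x powr (- \<alpha> - 1)) *\<^sub>R (indicator {..s} x * x) ^ k =
       indicator {r<..s} x * x powr (real k - \<alpha> - 1)"
      using assms k by (auto simp: indicator_def)
  qed
  have "has_bochner_integral lborel (\<lambda>x. indicator {r<..s} x * x powr (real k - \<alpha> - 1))
       ((s powr (k - \<alpha>) - r powr (k - \<alpha>)) / (k - \<alpha>))"
    using has_bochner_integral_powr_Ioc[of "real k - \<alpha> - 1" r s] assms by simp
  then have "has_bochner_integral (pareto \<alpha> r) (\<lambda>x. (indicator {..s} x * x) ^ k)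
    ((\<alpha> * r powr \<alpha>) *\<^sub>R ((s powr (k - \<alpha>) - r powr (k - \<alpha>)) / (k - \<alpha>)))"
    using assms by (intro has_bochner_integral_pareto) (simp_all only: eq, auto)
  then show ?thesis by simp
qed

section \<open>The Levy exponent and characteristic functions of restricted Pareto variables\<close>

definition levy_integrand :: "real \<Rightarrow> real \<Rightarrow> real \<Rightarrow> complex" where
  "levy_integrand \<alpha> t x = (iexp (t * x) - 1) / complex_of_real (x powr (\<alpha> + 1))"

lemma measurable_levy_integrand [measurable]: "levy_integrand \<alpha> t \<in> borel_measurable borel"
  unfolding levy_integrand_def by measurable

text \<open>On (0, 1] the estimate |exp(i t x) - 1| \<le> |t x| leaves x powr (- \<alpha>),
  integrable because \<alpha> < 1; beyond 1 the estimate by 2 leaves x powr (- \<alpha> - 1),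
  integrable because \<alpha> > 0.\<close>

lemma levy_integrand_integrable:
  assumes "0 < \<alpha>" "\<alpha> < 1"
  shows "integrable lborel (\<lambda>x. indicator {0<..} x *\<^sub>R levy_integrand \<alpha> t x)"
proof (rule Bochner_Integration.integrable_bound)
  let ?w = "\<lambda>x. \<bar>t\<bar> * (indicator {0<..1} x * x powr (-\<alpha>)) + 2 * (indicator {1<..} x * x powr (- \<alpha> - 1))"
  show "integrable lborel ?w"
    using has_bochner_integral_powr_at_0[of "-\<alpha>" 1] has_bochner_integral_powr_at_top[of \<alpha> 1] assms
    by (intro Bochner_Integration.integrable_add integrable_mult_right) (auto simp: has_bochner_integral_iff)
  show "AE x in lborel. norm (indicator {0<..} x *\<^sub>R levy_integrand \<alpha> t x) \<le> norm (?w x)"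
  proof (intro AE_I2)
    fix x :: real
    have 1: "cmod (iexp (t * x) - 1) \<le> \<bar>t * x\<bar>" "cmod (iexp (t * x) - 1) \<le> 2"
      using iexp_approx1[of "t * x" 0] iexp_approx2[of "t * x" 0] by simp_all
    have p: "x * x powr (- \<alpha> - 1) = x powr (- \<alpha>)" if "0 < x"
      using that powr_add[of x 1 "- \<alpha> - 1"] by simp
    have pw: "x powr (- \<alpha> - 1) = inverse (x powr (\<alpha> + 1))"
      by (simp add: powr_minus[symmetric])
    have n: "norm (levy_integrand \<alpha> t x) = cmod (iexp (t * x) - 1) * x powr (- \<alpha> - 1)"
      unfolding pw levy_integrand_def by (simp only: norm_mult norm_inverse norm_of_real abs_of_nonneg powr_ge_zero divide_inverse)
    show "norm (indicator {0<..} x *\<^sub>R levy_integrand \<alpha> t x) \<le> norm (?w x)"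
    proof (cases "0 < x \<and> x \<le> 1")
      case True
      then show ?thesis
        using mult_right_mono[OF 1(1), of "x powr (- \<alpha> - 1)"] p
        by (simp add: n abs_mult mult.assoc)
    next
      case False
      then show ?thesis
        using mult_right_mono[OF 1(2), of "x powr (- \<alpha> - 1)"]
        by (auto simp: n indicator_def)
    qed
  qed
qed measurable

lemma integrable_levy_integrand_on:
  assumes "0 < \<alpha>" "\<alpha> < 1" "D \<in> sets borel" "D \<subseteq> {0<..}"
  shows "integrable lborel (\<lambda>x. indicator D x *\<^sub>R levy_integrand \<alpha> t x)"
  using set_integrable_subset[of lborel "{0<..}" "levy_integrand \<alpha> t" D] levy_integrand_integrable[OF assms(1,2), of t] assms
  by (simp add: set_integrable_def)

text \<open>Multiplying by the indicator of \<open>D\<close> moves the discarded mass to 0, where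
  exp(i t x) - 1 vanishes. So after splitting off 1, only the integral over \<open>D\<close> above r
  remains.\<close>

lemma char_pareto_restrict:
  assumes "0 < \<alpha>" "\<alpha> < 1" "0 < r" and [measurable]: "D \<in> sets borel"
  shows "char (distr (pareto \<alpha> r) borel (\<lambda>x. indicator D x * x)) t =
    1 + (\<alpha> * r powr \<alpha>) *\<^sub>R (CLINT x:({r<..} \<inter> D)|lborel. levy_integrand \<alpha> t x)"
proof -
  interpret prob_space "pareto \<alpha> r" using assms by (intro prob_space_pareto)
  let ?h = "\<lambda>x. iexp (t * (indicator D x * x)) - 1"
  have eq: "(\<lambda>x. (indicator {r<..} x * x powr (- \<alpha> - 1)) *\<^sub>R ?h x) =
     (\<lambda>x. indicator ({r<..} \<inter> D) x *\<^sub>R levy_integrand \<alpha> t x)"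
  proof
    fix x :: real
    have pw: "x powr (- \<alpha> - 1) = inverse (x powr (\<alpha> + 1))"
      by (simp add: powr_minus[symmetric])
    show "(indicator {r<..} x * x powr (- \<alpha> - 1)) *\<^sub>R ?h x = indicator ({r<..} \<inter> D) x *\<^sub>R levy_integrand \<alpha> t x"
      by (cases "x \<in> D"; cases "r < x")
         (auto simp: pw indicator_def levy_integrand_def scaleR_conv_of_real divide_inverse)
  qed
  have "has_bochner_integral (pareto \<alpha> r) ?h ((\<alpha> * r powr \<alpha>) *\<^sub>R (CLINT x:({r<..} \<inter> D)|lborel. levy_integrand \<alpha> t x))"
  proof (rule has_bochner_integral_pareto)
    show "has_bochner_integral lborel (\<lambda>x. (indicator {r<..} x * x powr (- \<alpha> - 1)) *\<^sub>R ?h x)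
      (CLINT x:({r<..} \<inter> D)|lborel. levy_integrand \<alpha> t x)"
      unfolding eq set_lebesgue_integral_def
      using assms by (intro has_bochner_integral_integrable integrable_levy_integrand_on) auto
  qed (use assms in auto)
  moreover have "prob UNIV = 1" using prob_space by simp
  ultimately have "integral\<^sup>L (pareto \<alpha> r) (\<lambda>x. 1 + ?h x) = 1 + (\<alpha> * r powr \<alpha>) *\<^sub>R (CLINT x:({r<..} \<inter> D)|lborel. levy_integrand \<alpha> t x)"
    by (subst Bochner_Integration.integral_add) (auto simp: has_bochner_integral_iff)
  then show ?thesis by (simp add: char_def integral_distr)
qed

section \<open>Sums of truncated Pareto variables\<close>

text \<open>Restriction to \<open>I\<close> is the identity on the product space, so the joint law
  of the coordinates is the product of their marginals.\<close>

lemma indep_vars_PiM_coordinates: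
  assumes "\<And>i. i \<in> I \<Longrightarrow> prob_space (M i)" "I \<noteq> {}"
  shows "prob_space.indep_vars (PiM I M) M (\<lambda>i \<omega>. \<omega> i) I"
proof -
  interpret P: prob_space "PiM I M" using assms by (intro prob_space_PiM) auto
  have "distr (PiM I M) (PiM I M) (\<lambda>\<omega>. \<lambda>i\<in>I. \<omega> i) = distr (PiM I M) (PiM I M) (\<lambda>\<omega>. \<omega>)"
    by (intro distr_cong) (auto simp: space_PiM PiE_iff extensional_restrict)
  also have "\<dots> = PiM I (\<lambda>i. distr (PiM I M) (M i) (\<lambda>\<omega>. \<omega> i))"
    using assms by (simp add: distr_id distr_PiM_component cong: PiM_cong)
  finally show ?thesis using assms
    by (subst P.indep_vars_iff_distr_eq_PiM') auto
qed

lemma (in prob_space) indep_var_block_sums: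
  fixes X :: "'i \<Rightarrow> 'a \<Rightarrow> real"
  assumes "indep_vars (\<lambda>_. borel) X K" "I \<inter> J = {}" "I \<subseteq> K" "J \<subseteq> K"
  shows "indep_var borel (\<lambda>\<omega>. \<Sum>i\<in>I. X i \<omega>) borel (\<lambda>\<omega>. \<Sum>i\<in>J. X i \<omega>)"
proof -
  have "indep_var
    borel ((\<lambda>f. \<Sum>i\<in>I. f i) \<circ> (\<lambda>\<omega>. restrict (\<lambda>i. X i \<omega>) I))
    borel ((\<lambda>f. \<Sum>i\<in>J. f i) \<circ> (\<lambda>\<omega>. restrict (\<lambda>i. X i \<omega>) J))"
    using assms by (intro indep_var_compose[OF indep_var_restrict]) auto
  then show ?thesis by (simp add: comp_def)
qed

text \<open>The first N variables feed the sum truncated at \<open>s\<close>, the last N the sum of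
  values above \<open>s\<close>. Splitting one set of N variables at \<open>s\<close> would give
  dependent sums; separate copies make them exactly independent. The condition linking
  \<open>r\<close> and \<open>N\<close> gives each block of N variables the intensity x powr (-
  \<alpha> - 1) above r.\<close>

locale pareto_array = prob_space +
  fixes Z :: "nat \<Rightarrow> 'a \<Rightarrow> real" and N :: nat and \<alpha> r s :: real
  assumes \<alpha>: "0 < \<alpha>" "\<alpha> < 1" and N: "0 < N" and r: "0 < r" "\<alpha> * r powr \<alpha> = 1 / real N"
    and indep: "indep_vars (\<lambda>_. borel) Z {..<2 * N}"
    and law: "\<And>i. i < 2 * N \<Longrightarrow> distr M borel (Z i) = pareto \<alpha> r"
begin

definition summand :: "nat \<Rightarrow> 'a \<Rightarrow> real" where
  "summand i \<omega> = indicator (if i < N then {..s} else {s<..}) (Z i \<omega>) * Z i \<omega>"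

definition small :: "'a \<Rightarrow> real" where "small \<omega> = (\<Sum>i<N. summand i \<omega>)"
definition large :: "'a \<Rightarrow> real" where "large \<omega> = (\<Sum>i\<in>{N..<2 * N}. summand i \<omega>)"

lemma rv_Z: "i < 2 * N \<Longrightarrow> random_variable borel (Z i)"
  using indep by (auto simp: indep_vars_def)

lemma indep_summand: "indep_vars (\<lambda>_. borel) summand {..<2 * N}"
  using indep unfolding summand_def
  by (rule indep_vars_compose2[where Y = "\<lambda>i x. indicator (if i < N then {..s} else {s<..}) x * x"]) auto

lemma rv_summand: "i < 2 * N \<Longrightarrow> random_variable borel (summand i)"
  using indep_summand by (auto simp: indep_vars_def)

lemma rv_small [measurable]: "random_variable borel small"
  and rv_large [measurable]: "random_variable borel large"
  unfolding small_def large_def by (auto intro!: borel_measurable_sum rv_summand)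

lemma indep_small_large: "indep_var borel small borel large"
  unfolding small_def[abs_def] large_def[abs_def]
  by (rule indep_var_block_sums[OF indep_summand]) auto

lemma has_bochner_integral_Z:
  fixes f :: "real \<Rightarrow> real"
  assumes "i < 2 * N" "has_bochner_integral (pareto \<alpha> r) f v" and [measurable]: "f \<in> borel_measurable borel"
  shows "has_bochner_integral M (\<lambda>\<omega>. f (Z i \<omega>)) v"
  using assms(2) rv_Z[OF assms(1)] unfolding law[OF assms(1), symmetric]
  by (simp add: has_bochner_integral_iff integrable_distr_eq integral_distr)

lemma char_sum:
  "char (distr M borel (\<lambda>\<omega>. small \<omega> + large \<omega>)) t =
    char (distr (pareto \<alpha> r) borel (\<lambda>x. indicator {..s} x * x)) t ^ N *
    char (distr (pareto \<alpha> r) borel (\<lambda>x. indicator {s<..} x * x)) t ^ N"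
proof -
  have law': "distr M borel (summand i) = distr (pareto \<alpha> r) borel (\<lambda>x. indicator (if i < N then {..s} else {s<..}) x * x)"
    if "i < 2 * N" for i
    unfolding law[OF that, symmetric] summand_def using rv_Z[OF that]
    by (subst distr_distr) (auto simp: comp_def)
  have "char (distr M borel small) t = (\<Prod>i<N. char (distr M borel (summand i)) t)"
    unfolding small_def[abs_def]
    by (intro char_distr_sum indep_vars_subset[OF indep_summand]) auto
  moreover have "char (distr M borel large) t = (\<Prod>i\<in>{N..<2 * N}. char (distr M borel (summand i)) t)"
    unfolding large_def[abs_def]
    by (intro char_distr_sum indep_vars_subset[OF indep_summand]) auto
  ultimately show ?thesis
    by (subst char_distr_add[OF indep_small_large]) (simp add: law')
qed

section \<open>Moments and tails of the two sums when the truncation level is at least the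
  cutoff\<close>

context
  assumes rs: "r \<le> s"
begin

lemma summand_moment:
  assumes "i < N" "\<alpha> < real k"
  shows "has_bochner_integral M (\<lambda>\<omega>. summand i \<omega> ^ k) ((s powr (k - \<alpha>) - r powr (k - \<alpha>)) / (k - \<alpha>) / N)"
  using has_bochner_integral_Z[OF _ pareto_truncated_moment[OF \<alpha>(1) assms(2) r(1) rs], of i] assms r(2)
  by (simp add: summand_def mult.commute)

lemma expectation_small: "expectation small = (s powr (1 - \<alpha>) - r powr (1 - \<alpha>)) / (1 - \<alpha>)"
proof -
  have "integrable M (summand i)" "expectation (summand i) = (s powr (1 - \<alpha>) - r powr (1 - \<alpha>)) / (1 - \<alpha>) / N"
    if "i < N" for i
    using summand_moment[OF that, of 1] \<alpha> by (auto simp: has_bochner_integral_iff)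
  then show ?thesis unfolding small_def[abs_def] using N by simp
qed

lemma second_moment_small:
  shows "integrable M (\<lambda>\<omega>. (small \<omega>)\<^sup>2)"
    and "expectation (\<lambda>\<omega>. (small \<omega>)\<^sup>2) \<le> (expectation small)\<^sup>2 + s powr (2 - \<alpha>) / (2 - \<alpha>)"
proof -
  have i2: "integrable M (\<lambda>\<omega>. (summand i \<omega>)\<^sup>2)"
    "expectation (\<lambda>\<omega>. (summand i \<omega>)\<^sup>2) = (s powr (2 - \<alpha>) - r powr (2 - \<alpha>)) / (2 - \<alpha>) / N"
    if "i < N" for i
    using summand_moment[OF that, of 2] \<alpha> by (auto simp: has_bochner_integral_iff)
  have i1: "integrable M (summand i)" if "i < N" for i
    using summand_moment[OF that, of 1] \<alpha> by (auto simp: has_bochner_integral_iff)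
  have ind: "indep_vars (\<lambda>_. borel) summand {..<N}"
    by (rule indep_vars_subset[OF indep_summand]) auto
  show "integrable M (\<lambda>\<omega>. (small \<omega>)\<^sup>2)"
    unfolding small_def[abs_def] using i2 by (intro second_moment_indep_sum ind) auto
  have "expectation (\<lambda>\<omega>. (small \<omega>)\<^sup>2) \<le> (\<Sum>i<N. expectation (summand i))\<^sup>2 + (\<Sum>i<N. expectation (\<lambda>\<omega>. (summand i \<omega>)\<^sup>2))"
    unfolding small_def[abs_def] using i2 by (intro second_moment_indep_sum ind) auto
  also have "(\<Sum>i<N. expectation (summand i)) = expectation small"
    unfolding small_def[abs_def] using i1 by simp
  also have "(\<Sum>i<N. expectation (\<lambda>\<omega>. (summand i \<omega>)\<^sup>2)) = (s powr (2 - \<alpha>) - r powr (2 - \<alpha>)) / (2 - \<alpha>)"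
    using N i2 by simp
  also have "\<dots> \<le> s powr (2 - \<alpha>) / (2 - \<alpha>)"
    using \<alpha> by (intro divide_right_mono) auto
  finally show "expectation (\<lambda>\<omega>. (small \<omega>)\<^sup>2) \<le> (expectation small)\<^sup>2 + s powr (2 - \<alpha>) / (2 - \<alpha>)" by simp
qed

lemma prob_Z_tail:
  assumes "i < 2 * N" "s \<le> y"
  shows "prob {\<omega> \<in> space M. y < Z i \<omega>} = 1 / (\<alpha> * y powr \<alpha>) / N"
proof -
  have "r powr \<alpha> = 1 / real N / \<alpha>" using r(2) \<alpha>
    by (metis less_numeral_extra(3) nonzero_mult_div_cancel_left)
  then have "r powr \<alpha> / y powr \<alpha> = 1 / (\<alpha> * y powr \<alpha>) / N" by simp
  moreover have "has_bochner_integral M (\<lambda>\<omega>. indicator {y<..} (Z i \<omega>) :: real) (r powr \<alpha> / y powr \<alpha>)"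
    using assms r rs \<alpha> by (intro has_bochner_integral_Z has_bochner_integral_pareto_tail) auto
  moreover have "(\<lambda>\<omega>. indicator {y<..} (Z i \<omega>) :: real) = indicator {\<omega>. y < Z i \<omega>}"
    by (auto simp: indicator_def)
  moreover have "{\<omega>. y < Z i \<omega>} \<inter> space M = {\<omega> \<in> space M. y < Z i \<omega>}" by auto
  ultimately show ?thesis by (simp add: has_bochner_integral_iff)
qed

text \<open>A union bound: a nonzero sum needs some copy above \<open>s\<close>, and each of the N
  copies exceeds \<open>s\<close> with probability 1 / (\<alpha> * s powr \<alpha>) / N.\<close>

lemma prob_large_nonzero: "prob {\<omega> \<in> space M. large \<omega> \<noteq> 0} \<le> 1 / (\<alpha> * s powr \<alpha>)"
proof -
  have "prob {\<omega> \<in> space M. large \<omega> \<noteq> 0} \<le> prob (\<Union>i\<in>{N..<2 * N}. {\<omega> \<in> space M. s < Z i \<omega>})"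
  proof (intro finite_measure_mono)
    show "{\<omega> \<in> space M. large \<omega> \<noteq> 0} \<subseteq> (\<Union>i\<in>{N..<2 * N}. {\<omega> \<in> space M. s < Z i \<omega>})"
    proof (rule subsetI, rule ccontr)
      fix \<omega> assume \<omega>: "\<omega> \<in> {\<omega> \<in> space M. large \<omega> \<noteq> 0}" "\<omega> \<notin> (\<Union>i\<in>{N..<2 * N}. {\<omega> \<in> space M. s < Z i \<omega>})"
      then have "large \<omega> = 0" unfolding large_def summand_def
        by (intro sum.neutral) (auto simp: indicator_def)
      then show False using \<omega> by simp
    qed
  qed (use rv_Z in auto)
  also have "\<dots> \<le> (\<Sum>i\<in>{N..<2 * N}. prob {\<omega> \<in> space M. s < Z i \<omega>})"
    using rv_Z by (intro finite_measure_subadditive_finite) auto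
  also have "\<dots> = 1 / (\<alpha> * s powr \<alpha>)"
    using N by (simp add: prob_Z_tail)
  finally show ?thesis .
qed

text \<open>All summands are nonnegative because \<open>s\<close> is positive, so a single copy
  above \<open>y\<close> already makes the sum at least \<open>y\<close>. Independence turns the
  probability of having no such copy into an N-th power.\<close>

lemma prob_large_ge:
  assumes "s \<le> y"
  shows "1 / (1 + \<alpha> * y powr \<alpha>) \<le> prob {\<omega> \<in> space M. y \<le> large \<omega>}"
proof -
  let ?J = "{N..<2 * N}" and ?u = "1 / (\<alpha> * y powr \<alpha>)"
  have y: "0 < y" and s: "0 < s" using r rs assms by auto
  then have u: "0 < ?u" using \<alpha> by simp
  have indJ: "indep_vars (\<lambda>_. borel) Z ?J"
    by (rule indep_vars_subset[OF indep]) auto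
  have small_prob: "prob {\<omega> \<in> space M. Z i \<omega> \<le> y} = 1 - ?u / N" if "i < 2 * N" for i
  proof -
    have "{\<omega> \<in> space M. Z i \<omega> \<le> y} = space M - {\<omega> \<in> space M. y < Z i \<omega>}" by auto
    then show ?thesis using prob_compl[of "{\<omega> \<in> space M. y < Z i \<omega>}"] rv_Z[OF that] prob_Z_tail[OF that assms]
      by simp
  qed
  \<comment> \<open>The base 1 - u / N is nonnegative since it is a probability; this is what
    permits raising the exponential bound to the power N.\<close>
  have "0 \<le> prob {\<omega> \<in> space M. Z 0 \<omega> \<le> y}" by simp
  then have le1: "?u / N \<le> 1" using small_prob[of 0] N by simp
  have "prob (\<Inter>i\<in>?J. Z i -` {..y} \<inter> space M) = (\<Prod>i\<in>?J. prob (Z i -` {..y} \<inter> space M))"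
    using N by (intro indep_varsD_finite[OF indJ]) auto
  also have "\<dots> = (\<Prod>i\<in>?J. 1 - ?u / N)"
  proof (rule prod.cong)
    fix i assume "i \<in> ?J"
    moreover have "Z i -` {..y} \<inter> space M = {\<omega> \<in> space M. Z i \<omega> \<le> y}" by auto
    ultimately show "prob (Z i -` {..y} \<inter> space M) = 1 - ?u / N" using small_prob[of i] by simp
  qed simp
  also have "\<dots> = (1 - ?u / N) ^ N" by simp
  also have "\<dots> \<le> exp (- ?u / N) ^ N"
    using le1 exp_ge_add_one_self[of "- ?u / N"] by (intro power_mono) auto
  also have "\<dots> = exp (- ?u)" using N by (simp add: exp_of_nat_mult[symmetric])
  also have "\<dots> \<le> 1 / (1 + ?u)"
    unfolding exp_minus inverse_eq_divide using u by (intro divide_left_mono exp_ge_add_one_self mult_pos_pos add_pos_pos) auto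
  also have "\<dots> = 1 - 1 / (1 + \<alpha> * y powr \<alpha>)"
  proof -
    have "1 / (1 + 1 / p) = 1 - 1 / (1 + p)" if "0 < p" for p :: real
      using that by (simp add: field_simps)
    then show ?thesis using \<alpha> y by simp
  qed
  finally have "1 / (1 + \<alpha> * y powr \<alpha>) \<le> 1 - prob (\<Inter>i\<in>?J. Z i -` {..y} \<inter> space M)" by simp
  also have "\<dots> = prob (space M - (\<Inter>i\<in>?J. Z i -` {..y} \<inter> space M))"
    using N rv_Z by (intro prob_compl[symmetric] sets.finite_INT) (auto intro: measurable_sets)
  also have "\<dots> \<le> prob {\<omega> \<in> space M. y \<le> large \<omega>}"
  proof (intro finite_measure_mono subsetI)
    fix \<omega> assume "\<omega> \<in> space M - (\<Inter>i\<in>?J. Z i -` {..y} \<inter> space M)"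
    then obtain j where j: "\<omega> \<in> space M" "j \<in> ?J" "y < Z j \<omega>" using N by (auto simp: not_le)
    have "y \<le> summand j \<omega>" using j assms by (auto simp: summand_def)
    also have "\<dots> \<le> large \<omega>" unfolding large_def
      using j s by (intro member_le_sum) (auto simp: summand_def indicator_def)
    finally show "\<omega> \<in> {\<omega> \<in> space M. y \<le> large \<omega>}" using j by simp
  qed measurable
  finally show ?thesis .
qed

text \<open>If the truncated sum is less than 2 s from its mean and the other sum is 0, the total is
  below the mean plus 2 s, hence below 1 / (1 - \<alpha>) + 3 s. The two exceptional events have
  probability at most 1 / (\<alpha> * s powr \<alpha>) each.\<close>

lemma upper_tail:
  assumes "1 \<le> s"
  shows "prob {\<omega> \<in> space M. 1 / (1 - \<alpha>) + 3 * s < small \<omega> + large \<omega>} \<le> 2 / (\<alpha> * s powr \<alpha>)"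
proof -
  let ?D = "{\<omega> \<in> space M. 2 * s \<le> \<bar>small \<omega> - expectation small\<bar>}" and ?L = "{\<omega> \<in> space M. large \<omega> \<noteq> 0}"
  \<comment> \<open>Weighted AM-GM for s and 1 with weights 1 - \<alpha> and \<alpha>; the constant
    term \<alpha> is then enlarged to 1.\<close>
  have "s powr (1 - \<alpha>) \<le> 1 + (1 - \<alpha>) * s"
    using Youngs_inequality_0[of "1 - \<alpha>" \<alpha> s 1] \<alpha> assms by simp
  then have "s powr (1 - \<alpha>) / (1 - \<alpha>) \<le> (1 + (1 - \<alpha>) * s) / (1 - \<alpha>)"
    using \<alpha> by (intro divide_right_mono) auto
  also have "\<dots> = 1 / (1 - \<alpha>) + s"
    using \<alpha> by (simp add: add_divide_distrib)
  finally have "s powr (1 - \<alpha>) / (1 - \<alpha>) \<le> 1 / (1 - \<alpha>) + s" .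
  moreover have "expectation small \<le> s powr (1 - \<alpha>) / (1 - \<alpha>)"
    unfolding expectation_small using \<alpha> by (intro divide_right_mono) auto
  ultimately have mean: "expectation small \<le> 1 / (1 - \<alpha>) + s" by linarith
  have "integrable M small"
    by (rule square_integrable_imp_integrable[OF _ second_moment_small(1)]) simp
  then have "variance small \<le> s powr (2 - \<alpha>) / (2 - \<alpha>)"
    using second_moment_small by (simp add: variance_eq)
  also have "\<dots> \<le> s powr (2 - \<alpha>) / 1"
    using \<alpha> by (intro divide_left_mono) auto
  also have "\<dots> = s\<^sup>2 / s powr \<alpha>"
    using assms by (simp add: powr_diff)
  \<comment> \<open>Dividing by \<alpha> < 1 enlarges the bound to the form of the one for the large
    values; Chebyshev's (2 s)^2 then leaves a spare factor 1/4.\<close>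
  also have "\<dots> \<le> s\<^sup>2 / (\<alpha> * s powr \<alpha>)"
    using \<alpha> assms by (intro divide_left_mono) auto
  finally have var: "variance small / (2 * s)\<^sup>2 \<le> (s\<^sup>2 / (\<alpha> * s powr \<alpha>)) / (2 * s)\<^sup>2"
    by (rule divide_right_mono) simp
  have "prob ?D \<le> variance small / (2 * s)\<^sup>2"
    using assms second_moment_small by (intro Chebyshev_inequality) auto
  also note var
  also have "(s\<^sup>2 / (\<alpha> * s powr \<alpha>)) / (2 * s)\<^sup>2 \<le> 1 / (\<alpha> * s powr \<alpha>)"
    using assms \<alpha> by (simp add: field_simps power2_eq_square)
  finally have D: "prob ?D \<le> 1 / (\<alpha> * s powr \<alpha>)" .
  have "prob {\<omega> \<in> space M. 1 / (1 - \<alpha>) + 3 * s < small \<omega> + large \<omega>} \<le> prob (?D \<union> ?L)"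
    using mean by (intro finite_measure_mono) auto
  also have "\<dots> \<le> prob ?D + prob ?L"
    by (rule measure_Un_le) measurable
  also have "\<dots> \<le> 1 / (\<alpha> * s powr \<alpha>) + 1 / (\<alpha> * s powr \<alpha>)"
    by (intro add_mono D prob_large_nonzero)
  finally show ?thesis by simp
qed

text \<open>The independent events a \<le> \<open>small\<close> and y \<le> \<open>large\<close>
  together force the sum to be at least a + y. The free bound \<open>K\<close> can be chosen
  independently of the cutoff, on which the mean depends.\<close>

lemma lower_tail:
  assumes "s \<le> y" "0 \<le> a" "a \<le> expectation small" "(expectation small)\<^sup>2 + s powr (2 - \<alpha>) / (2 - \<alpha>) \<le> K"
  shows "(expectation small - a)\<^sup>2 / K * (1 / (1 + \<alpha> * y powr \<alpha>))
    \<le> prob {\<omega> \<in> space M. a + y \<le> small \<omega> + large \<omega>}"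
proof -
  have "0 < s powr (2 - \<alpha>) / (2 - \<alpha>)" using r rs \<alpha> by simp
  then have "0 < K" using assms(4) zero_le_power2[of "expectation small"] by linarith
  then have A: "(expectation small - a)\<^sup>2 / K \<le> prob {\<omega> \<in> space M. a \<le> small \<omega>}"
    using assms second_moment_small by (intro second_moment_lower_tail) auto
  have "(expectation small - a)\<^sup>2 / K * (1 / (1 + \<alpha> * y powr \<alpha>))
    \<le> prob {\<omega> \<in> space M. a \<le> small \<omega>} * prob {\<omega> \<in> space M. y \<le> large \<omega>}"
    using \<open>0 < K\<close> \<alpha> by (intro mult_mono A prob_large_ge assms) auto
  also have "\<dots> = prob {\<omega> \<in> space M. small \<omega> \<in> {a..} \<and> large \<omega> \<in> {y..}}"
    using prob_indep_random_variable[OF indep_small_large, of "{a..}" "{y..}"] by simp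
  also have "\<dots> \<le> prob {\<omega> \<in> space M. a + y \<le> small \<omega> + large \<omega>}"
    by (intro finite_measure_mono) auto
  finally show ?thesis .
qed

end

end

section \<open>Passage to the stable limit\<close>

text \<open>The solution r of \<alpha> * r powr \<alpha> = 1 / (n + 1); the shift by one keeps the
  number of copies positive.\<close>

definition cutoff :: "real \<Rightarrow> nat \<Rightarrow> real" where
  "cutoff \<alpha> n = (\<alpha> * real (Suc n)) powr (- 1 / \<alpha>)"

text \<open>The array is realised by the coordinates of a product space. The level \<open>s\<close>
  stays fixed as n grows, so each tail estimate can choose its own.\<close>

definition stable_approx :: "real \<Rightarrow> real \<Rightarrow> nat \<Rightarrow> real measure" where
  "stable_approx \<alpha> s n = distr (PiM {..<2 * Suc n} (\<lambda>_. pareto \<alpha> (cutoff \<alpha> n))) borel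
     (\<lambda>\<omega>. pareto_array.small (\<lambda>i \<omega>. \<omega> i) (Suc n) s \<omega> + pareto_array.large (\<lambda>i \<omega>. \<omega> i) (Suc n) s \<omega>)"

context
  fixes \<alpha> :: real
  assumes \<alpha>: "0 < \<alpha>" "\<alpha> < 1"
begin

lemma cutoff_pos: "0 < cutoff \<alpha> n"
  using \<alpha> by (simp add: cutoff_def)

lemma cutoff_powr: "\<alpha> * cutoff \<alpha> n powr \<alpha> = 1 / real (Suc n)"
proof -
  have "cutoff \<alpha> n powr \<alpha> = (\<alpha> * real (Suc n)) powr (- 1)"
    using \<alpha> unfolding cutoff_def by (subst powr_powr) simp
  also have "\<dots> = inverse (\<alpha> * real (Suc n))"
    using \<alpha> by (simp add: powr_minus del: of_nat_Suc)
  finally show ?thesis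
    using \<alpha> by (simp add: divide_inverse del: of_nat_Suc)
qed

lemma cutoff_tendsto_0: "cutoff \<alpha> \<longlonglongrightarrow> 0"
proof -
  have "filterlim (\<lambda>n. \<alpha> * real (Suc n)) at_top sequentially"
    using \<alpha> by (intro filterlim_tendsto_pos_mult_at_top[OF tendsto_const])
      (auto intro: filterlim_compose[OF filterlim_real_sequentially filterlim_Suc] simp del: of_nat_Suc)
  then show ?thesis
    unfolding cutoff_def using \<alpha> by (intro tendsto_neg_powr) auto
qed

text \<open>One copy has characteristic function 1 + c n / (n + 1), where c n integrates the Levy
  integrand over the part of \<open>D\<close> above the cutoff. Dominated convergence gives the
  limit of c n, and \<open>exp_limit_Suc\<close> that of the power.\<close>

lemma char_pareto_power_limit:
  assumes [measurable]: "D \<in> sets borel"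
  shows "(\<lambda>n. char (distr (pareto \<alpha> (cutoff \<alpha> n)) borel (\<lambda>x. indicator D x * x)) t ^ Suc n)
    \<longlonglongrightarrow> exp (CLINT x:({0<..} \<inter> D)|lborel. levy_integrand \<alpha> t x)"
proof -
  let ?r = "cutoff \<alpha>"
  have ch: "char (distr (pareto \<alpha> (?r n)) borel (\<lambda>x. indicator D x * x)) t =
    1 + (CLINT x:({?r n<..} \<inter> D)|lborel. levy_integrand \<alpha> t x) / of_nat (Suc n)" for n
    using char_pareto_restrict[OF \<alpha> cutoff_pos assms, of n t] cutoff_powr[of n]
    by (simp add: scaleR_conv_of_real divide_inverse mult.commute del: of_nat_Suc)
  have "(\<lambda>n. CLINT x:({?r n<..} \<inter> D)|lborel. levy_integrand \<alpha> t x) \<longlonglongrightarrow>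
     (CLINT x:({0<..} \<inter> D)|lborel. levy_integrand \<alpha> t x)"
    unfolding set_lebesgue_integral_def
  proof (rule integral_dominated_convergence)
    show "integrable lborel (\<lambda>x. norm (indicator {0<..} x *\<^sub>R levy_integrand \<alpha> t x))"
      by (intro integrable_norm levy_integrand_integrable \<alpha>)
    show "AE x in lborel. (\<lambda>n. indicator ({?r n<..} \<inter> D) x *\<^sub>R levy_integrand \<alpha> t x)
        \<longlonglongrightarrow> indicator ({0<..} \<inter> D) x *\<^sub>R levy_integrand \<alpha> t x"
    proof (intro AE_I2 tendsto_eventually)
      fix x :: real
      show "\<forall>\<^sub>F n in sequentially. indicator ({?r n<..} \<inter> D) x *\<^sub>R levy_integrand \<alpha> t x
        = indicator ({0<..} \<inter> D) x *\<^sub>R levy_integrand \<alpha> t x"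
      proof (cases "0 < x")
        case True
        then have "\<forall>\<^sub>F n in sequentially. ?r n < x" using cutoff_tendsto_0 by (simp add: order_tendsto_iff)
        then show ?thesis using True by (auto elim!: eventually_mono simp: indicator_def)
      next
        case False
        then have "\<not> ?r n < x" for n using cutoff_pos[of n] by linarith
        then show ?thesis using False by (simp add: indicator_def)
      qed
    qed
    show "AE x in lborel. norm (indicator ({?r n<..} \<inter> D) x *\<^sub>R levy_integrand \<alpha> t x)
      \<le> norm (indicator {0<..} x *\<^sub>R levy_integrand \<alpha> t x)" for n
      using less_trans[OF cutoff_pos[of n]] by (auto simp: indicator_def)
  qed measurable
  \<comment> \<open>The expression is a characteristic function, hence of modulus at most 1.\<close>
  moreover have "norm (1 + (CLINT x:({?r n<..} \<inter> D)|lborel. levy_integrand \<alpha> t x) / of_nat (Suc n)) \<le> 1" for n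
  proof -
    interpret prob_space "pareto \<alpha> (?r n)" using \<alpha> cutoff_pos by (intro prob_space_pareto)
    interpret R: real_distribution "distr (pareto \<alpha> (?r n)) borel (\<lambda>x. indicator D x * x)"
      by (rule real_distribution_distr) measurable
    show ?thesis using R.cmod_char_le_1[of t] unfolding ch .
  qed
  ultimately show ?thesis
    unfolding ch by (intro exp_limit_Suc)
qed

lemma pareto_array_PiM:
  "pareto_array (PiM {..<2 * Suc n} (\<lambda>_. pareto \<alpha> (cutoff \<alpha> n))) (\<lambda>i \<omega>. \<omega> i) (Suc n) \<alpha> (cutoff \<alpha> n)"
proof -
  let ?P = "pareto \<alpha> (cutoff \<alpha> n)" and ?I = "{..<2 * Suc n}"
  have P: "prob_space ?P" using \<alpha> cutoff_pos by (intro prob_space_pareto)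
  interpret prob_space "PiM ?I (\<lambda>_. ?P)" using P by (intro prob_space_PiM)
  have "indep_vars (\<lambda>_. ?P) (\<lambda>i \<omega>. \<omega> i) ?I"
    using P by (intro indep_vars_PiM_coordinates) auto
  then have ind: "indep_vars (\<lambda>_. borel) (\<lambda>i \<omega>. \<omega> i) ?I"
    using indep_vars_compose2[of "\<lambda>_. ?P" "\<lambda>i \<omega>. \<omega> i" ?I "\<lambda>_ x. x" "\<lambda>_. borel"] by simp
  have "distr (PiM ?I (\<lambda>_. ?P)) borel (\<lambda>\<omega>. \<omega> i) = ?P" if "i \<in> ?I" for i
    using distr_PiM_component[of ?I "\<lambda>_. ?P" i] P that by (simp cong: distr_cong)
  then show ?thesis
    using \<alpha> cutoff_pos cutoff_powr ind by unfold_locales auto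
qed

lemma real_distribution_stable_approx: "real_distribution (stable_approx \<alpha> s n)"
proof -
  interpret pareto_array "PiM {..<2 * Suc n} (\<lambda>_. pareto \<alpha> (cutoff \<alpha> n))" "\<lambda>i \<omega>. \<omega> i" "Suc n" \<alpha> "cutoff \<alpha> n" s
    by (rule pareto_array_PiM)
  show ?thesis unfolding stable_approx_def by (rule real_distribution_distr) measurable
qed

lemma measure_stable_approx:
  assumes "A \<in> sets borel"
  shows "measure (stable_approx \<alpha> s n) A = measure (PiM {..<2 * Suc n} (\<lambda>_. pareto \<alpha> (cutoff \<alpha> n)))
    {\<omega> \<in> space (PiM {..<2 * Suc n} (\<lambda>_. pareto \<alpha> (cutoff \<alpha> n))).
      pareto_array.small (\<lambda>i \<omega>. \<omega> i) (Suc n) s \<omega> + pareto_array.large (\<lambda>i \<omega>. \<omega> i) (Suc n) s \<omega> \<in> A}"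
proof -
  interpret pareto_array "PiM {..<2 * Suc n} (\<lambda>_. pareto \<alpha> (cutoff \<alpha> n))" "\<lambda>i \<omega>. \<omega> i" "Suc n" \<alpha> "cutoff \<alpha> n" s
    by (rule pareto_array_PiM)
  have "random_variable borel (\<lambda>\<omega>. small \<omega> + large \<omega>)" by measurable
  from measure_distr[OF this assms] show ?thesis unfolding stable_approx_def
    by (simp add: vimage_def Int_def conj_commute del: mult_Suc_right)
qed

text \<open>The two sums contribute the exponents over (0, s] and over the values above s; these add
  up to the full exponent, so the limit is the same for every \<open>s\<close>.\<close>

lemma stable_approx_weak_conv:
  fixes s :: real and M :: "real measure"
  assumes "real_distribution M"
    and char: "\<And>t. char M t = exp (CLINT x:{0<..}|lborel. levy_integrand \<alpha> t x)"
  shows "weak_conv_m (stable_approx \<alpha> s) M"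
proof (rule levy_continuity)
  fix t
  let ?I = "\<lambda>D. CLINT x:({0<..} \<inter> D)|lborel. levy_integrand \<alpha> t x"
  have "char (stable_approx \<alpha> s n) t =
    char (distr (pareto \<alpha> (cutoff \<alpha> n)) borel (\<lambda>x. indicator {..s} x * x)) t ^ Suc n *
    char (distr (pareto \<alpha> (cutoff \<alpha> n)) borel (\<lambda>x. indicator {s<..} x * x)) t ^ Suc n" for n
    unfolding stable_approx_def by (rule pareto_array.char_sum[OF pareto_array_PiM])
  then have "(\<lambda>n. char (stable_approx \<alpha> s n) t) \<longlonglongrightarrow> exp (?I {..s}) * exp (?I {s<..})"
    by (simp only:) (intro tendsto_mult char_pareto_power_limit, auto)
  also have "exp (?I {..s}) * exp (?I {s<..}) = exp (?I {..s} + ?I {s<..})"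
    by (simp add: exp_add)
  also have "?I {..s} + ?I {s<..} = (CLINT x:({0<..} \<inter> {..s}) \<union> ({0<..} \<inter> {s<..})|lborel. levy_integrand \<alpha> t x)"
    using \<alpha> by (intro set_integral_Un[symmetric])
      (auto simp: set_integrable_def intro!: integrable_levy_integrand_on)
  also have "({0<..} \<inter> {..s}) \<union> ({0<..} \<inter> {s<..}) = {0<..}" by auto
  finally show "(\<lambda>n. char (stable_approx \<alpha> s n) t) \<longlonglongrightarrow> char M t"
    by (simp add: char)
qed (use assms real_distribution_stable_approx in auto)

text \<open>Truncating at \<open>y\<close> itself makes the prelimit bound free of n, valid once the
  cutoff is below \<open>y\<close>.\<close>

lemma stable_upper_tail:
  fixes y :: real and M :: "real measure"
  assumes M: "real_distribution M" "\<And>t. char M t = exp (CLINT x:{0<..}|lborel. levy_integrand \<alpha> t x)"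
    and "1 \<le> y"
  shows "measure M {1 / (1 - \<alpha>) + 3 * y<..} \<le> 2 / (\<alpha> * y powr \<alpha>)"
proof (rule weak_conv_upper_tail)
  show "weak_conv_m (stable_approx \<alpha> y) M"
    using assms by (intro stable_approx_weak_conv) auto
  have "\<forall>\<^sub>F n in sequentially. cutoff \<alpha> n < y"
    using cutoff_tendsto_0 \<open>1 \<le> y\<close> by (simp add: order_tendsto_iff)
  then show "\<forall>\<^sub>F n in sequentially. measure (stable_approx \<alpha> y n) {1 / (1 - \<alpha>) + 3 * y<..} \<le> 2 / (\<alpha> * y powr \<alpha>)"
  proof eventually_elim
    case (elim n)
    then show ?case
      using pareto_array.upper_tail[OF pareto_array_PiM[of n], of y] \<open>1 \<le> y\<close>
      by (simp add: measure_stable_approx del: mult_Suc_right)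
  qed
qed (use assms real_distribution_stable_approx in auto)

lemma stable_lower_tail:
  fixes y \<theta> :: real and M :: "real measure"
  assumes M: "real_distribution M" "\<And>t. char M t = exp (CLINT x:{0<..}|lborel. levy_integrand \<alpha> t x)"
    and "1 \<le> y" "0 < \<theta>" "\<theta> < 1"
  shows "2 / 3 * (1 - \<theta>)\<^sup>2 * (1 / (1 + \<alpha> * y powr \<alpha>)) \<le> measure M {\<theta> / (1 - \<alpha>) + y..}"
proof -
  \<comment> \<open>\<open>m n\<close> is the mean of the sum truncated at 1, and \<open>K\<close>
    bounds its second moment for all large n.\<close>
  define m where "m n = (1 - cutoff \<alpha> n powr (1 - \<alpha>)) / (1 - \<alpha>)" for n
  define K where "K = (1 / (1 - \<alpha>))\<^sup>2 + 1 / (2 - \<alpha>)"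
  let ?a = "\<theta> / (1 - \<alpha>)" and ?q = "1 / (1 + \<alpha> * y powr \<alpha>)"
  \<comment> \<open>The limit is 0, the exponent being positive, so the means increase to all of 1 /
    (1 - \<alpha>).\<close>
  have "(\<lambda>n. cutoff \<alpha> n powr (1 - \<alpha>)) \<longlonglongrightarrow> 0 powr (1 - \<alpha>)"
    using \<alpha> cutoff_pos by (intro tendsto_powr2 cutoff_tendsto_0 tendsto_const) (auto intro: less_imp_le always_eventually)
  then have "m \<longlonglongrightarrow> (1 - 0 powr (1 - \<alpha>)) / (1 - \<alpha>)"
    unfolding m_def using \<alpha> by (intro tendsto_divide tendsto_diff tendsto_const) auto
  then have m: "m \<longlonglongrightarrow> 1 / (1 - \<alpha>)" by simp
  have "((1 / (1 - \<alpha>)) - ?a)\<^sup>2 / K * ?q \<le> measure M {?a + y..}"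
  proof (rule weak_conv_lower_tail)
    show "weak_conv_m (stable_approx \<alpha> 1) M"
      using assms by (intro stable_approx_weak_conv) auto
    show "(\<lambda>n. (m n - ?a)\<^sup>2 / K * ?q) \<longlonglongrightarrow> ((1 / (1 - \<alpha>)) - ?a)\<^sup>2 / K * ?q"
      unfolding divide_inverse[of _ K] by (intro tendsto_intros m)
    have "?a < 1 / (1 - \<alpha>)" using \<alpha> assms by (intro divide_strict_right_mono) auto
    then have "\<forall>\<^sub>F n in sequentially. ?a < m n" using m by (simp add: order_tendsto_iff)
    moreover have "\<forall>\<^sub>F n in sequentially. cutoff \<alpha> n < 1"
      using cutoff_tendsto_0 by (simp add: order_tendsto_iff)
    ultimately show "\<forall>\<^sub>F n in sequentially. (m n - ?a)\<^sup>2 / K * ?q \<le> measure (stable_approx \<alpha> 1 n) {?a + y..}"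
    proof eventually_elim
      case (elim n)
      interpret pareto_array "PiM {..<2 * Suc n} (\<lambda>_. pareto \<alpha> (cutoff \<alpha> n))" "\<lambda>i \<omega>. \<omega> i" "Suc n" \<alpha> "cutoff \<alpha> n" 1
        by (rule pareto_array_PiM)
      have E: "expectation small = m n"
        using expectation_small elim by (simp add: m_def)
      have "0 \<le> m n" using elim \<alpha> assms by (smt (verit) divide_pos_pos)
      moreover have "m n \<le> 1 / (1 - \<alpha>)"
        unfolding m_def using \<alpha> by (intro divide_right_mono) auto
      ultimately have "(m n)\<^sup>2 \<le> (1 / (1 - \<alpha>))\<^sup>2" by (intro power_mono)
      then have "(expectation small)\<^sup>2 + 1 powr (2 - \<alpha>) / (2 - \<alpha>) \<le> K" by (simp add: E K_def del: mult_Suc_right)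
      with lower_tail[of y ?a K] elim assms \<alpha> show ?case
        by (simp add: measure_stable_approx E del: mult_Suc_right)
    qed
  qed (use assms real_distribution_stable_approx in auto)
  moreover have "2 / 3 * (1 - \<theta>)\<^sup>2 * ?q \<le> ((1 / (1 - \<alpha>)) - ?a)\<^sup>2 / K * ?q"
  proof (intro mult_right_mono)
    \<comment> \<open>Source of the constant 2/3: (1 - \<alpha>)^2 \<le> 1 - \<alpha> \<le> (2 -
      \<alpha>) / 2, so the variance term of \<open>K\<close> is at most half of the squared
      limiting mean.\<close>
    have "(1 - \<alpha>)\<^sup>2 \<le> (1 - \<alpha>) * 1" unfolding power2_eq_square using \<alpha> by (intro mult_left_mono) auto
    then have "(1 - \<alpha>)\<^sup>2 / (2 - \<alpha>) \<le> 1 / 2" using \<alpha> by (simp add: field_simps)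
    then have "(1 / (1 - \<alpha>))\<^sup>2 * ((1 - \<alpha>)\<^sup>2 / (2 - \<alpha>)) \<le> (1 / (1 - \<alpha>))\<^sup>2 * (1 / 2)"
      by (intro mult_left_mono) auto
    then have K: "K \<le> (1 / (1 - \<alpha>))\<^sup>2 * (3 / 2)" using \<alpha> by (simp add: K_def power_divide)
    have "0 < K" unfolding K_def using \<alpha> by (intro add_pos_pos) auto
    have "2 / 3 * (1 - \<theta>)\<^sup>2 = ((1 / (1 - \<alpha>)) - ?a)\<^sup>2 / ((1 / (1 - \<alpha>))\<^sup>2 * (3 / 2))"
      using \<alpha> by (simp add: diff_divide_distrib[symmetric] power_divide)
    also have "\<dots> \<le> ((1 / (1 - \<alpha>)) - ?a)\<^sup>2 / K"
      using K \<open>0 < K\<close> \<alpha> by (intro divide_left_mono mult_pos_pos) auto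
    finally show "2 / 3 * (1 - \<theta>)\<^sup>2 \<le> ((1 / (1 - \<alpha>)) - ?a)\<^sup>2 / K" .
  qed (use \<alpha> in simp)
  ultimately show ?thesis by linarith
qed

end

theorem theorem6:
  fixes M :: "'a measure" and X :: "'a \<Rightarrow> real" and \<alpha> :: real
  assumes "prob_space M"
    and "X \<in> borel_measurable M"
    and "0 < \<alpha>" and "\<alpha> < 1"
    and "\<And>t::real. char (distr M borel X) t =
           exp (CLINT x:{0<..}|lborel. (iexp (t * x) - 1) / complex_of_real (x powr (\<alpha> + 1)))"
  shows "(\<forall>y::real. y \<ge> (1 / \<alpha>) powr (1 / \<alpha>) \<longrightarrow>
            measure M {\<omega> \<in> space M. X \<omega> > 1 / (1 - \<alpha>) + 3 * y} \<le> 2 / (\<alpha> * y powr \<alpha>))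
       \<and> (\<forall>y::real. \<forall>\<theta>::real. y \<ge> 1 \<longrightarrow> 0 < \<theta> \<longrightarrow> \<theta> < 1 \<longrightarrow>
            measure M {\<omega> \<in> space M. X \<omega> \<ge> \<theta> / (1 - \<alpha>) + y}
              \<ge> 2 / 3 * (1 - \<theta>)^2 * (1 / (1 + \<alpha> * y powr \<alpha>)))"
proof -
  interpret prob_space M by fact
  have X [measurable]: "random_variable borel X" by fact
  have D: "real_distribution (distr M borel X)" by simp
  have char: "char (distr M borel X) t = exp (CLINT x:{0<..}|lborel. levy_integrand \<alpha> t x)" for t
    using assms(5) by (simp add: levy_integrand_def)
  have tail: "measure (distr M borel X) A = prob {\<omega> \<in> space M. X \<omega> \<in> A}" if "A \<in> sets borel" for A
    using that by (subst measure_distr) (auto intro!: arg_cong[where f = prob])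
  \<comment> \<open>Places the values of y in the first claim within the range of
    \<open>stable_upper_tail\<close>.\<close>
  have "1 \<le> (1 / \<alpha>) powr (1 / \<alpha>)"
    using assms(3,4) by (intro ge_one_powr_ge_zero) auto
  then show ?thesis
    using stable_upper_tail[OF assms(3,4) D char] stable_lower_tail[OF assms(3,4) D char]
    by (auto simp: tail)
qed

end
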